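(* Let $(X,d,\preceq)$ be an ordered metric space, $F:X^n\to X$ a mapping, $\ast\in\mathfrak B_n$, and let $E$ be a subspace of $X$ such that $F(X^n)\subseteq E$. Suppose that $F$ has the monotone property and that there exists $\varphi\in\Omega$ such that at least one of the following two contractivity conditions holds for all $x_1,\dots,x_n,y_1,\dots,y_n\in X$ with [$x_i\preceq y_i$ for each $i\in I_n$] or [$x_i\succeq y_i$ for each $i\in I_n$]: $$\frac1n\sum_{i=1}^n d\big(F(x_{i_1},\dots,x_{i_n}),F(y_{i_1},\dots,y_{i_n})\big)\le\varphi\Big(\frac1n\sum_{i=1}^n d(x_i,y_i)\Big),$$ or alternatively $$\max_{i\in I_n} d\big(F(x_{i_1},\dots,x_{i_n}),F(y_{i_1},\dots,y_{i_n})\big)\le\varphi\Big(\max_{i\in I_n} d(x_i,y_i)\Big).$$ Suppose moreover that one of the following sets of hypotheses (A), (B), (C) holds: (A) $E$ is $\overline{\mathrm O}$-complete; either $F$ is $\overline{\mathrm O}$-continuous or $(E,d,\preceq)$ has the ICU property; and there exist $x^{(0)}_1,\dots,x^{(0)}_n\in X$ with $x^{(0)}_i\preceq F(x^{(0)}_{i_1},\dots,x^{(0)}_{i_n})$ for each $i\in I_n$; (B) $E$ is $\underline{\mathrm O}$-complete; either $F$ is $\underline{\mathrm O}$-continuous or $(E,d,\preceq)$ has the DCL property; and there exist $x^{(0)}_1,\dots,x^{(0)}_n\in X$ with $x^{(0)}_i\succeq F(x^{(0)}_{i_1},\dots,x^{(0)}_{i_n})$ for each $i\in I_n$; (C) $E$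 is $\mathrm O$-complete; either $F$ is $\mathrm O$-continuous or $(E,d,\preceq)$ has the MCB property; and there exist $x^{(0)}_1,\dots,x^{(0)}_n\in X$ with either $x^{(0)}_i\preceq F(x^{(0)}_{i_1},\dots,x^{(0)}_{i_n})$ for each $i\in I_n$ or $x^{(0)}_i\succeq F(x^{(0)}_{i_1},\dots,x^{(0)}_{i_n})$ for each $i\in I_n$. Suppose finally that for every pair $(x_1,\dots,x_n),(y_1,\dots,y_n)\in X^n$ there exists $(z_1,\dots,z_n)\in X^n$ which is comparable to both $(x_1,\dots,x_n)$ and $(y_1,\dots,y_n)$ with respect to the partial order $\sqsubseteq_n$. Then $F$ has a unique $\ast$-fixed point.
   Context: Throughout, $n\ge 2$ is a fixed integer, $I_n=\{1,\dots,n\}$, and sequences are indexed by $m\in\mathbb N_0$. An ordered metric space $(X,d,\preceq)$ is a nonempty set $X$ with a metric $d$ and a partial order $\preceq$; $x\succeq y$ means $y\preceq x$. A subspace is a nonempty subset with the restricted metric and order. On $X^n$, $(x_1,\dots,x_n)\sqsubseteq_n(y_1,\dots,y_n)$ iff $x_i\preceq y_i$ for each $i\in I_n$; two elements are comparable if one is $\sqsubseteq_n$ the other. $\mathfrak B_n$ is the set of all binary operations $\ast:I_n\times I_n\to I_n$; for $\ast\in\mathfrak B_n$ write $i_k:=\ast(i,k)$. A sequence $\{x^{(m)}\}$ is increasing (decreasing) if $x^{(m)}\preceq x^{(m+1)}$ (resp. $x^{(m)}\succeq x^{(m+1)}$) for all $m$, and monotone if it is increasing or decreasing. $x^{(m)}\uparrow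 x$, $x^{(m)}\downarrow x$, $x^{(m)}\uparrow\downarrow x$ mean that $\{x^{(m)}\}$ converges to $x$ in $d$ and is, respectively, increasing, decreasing, monotone. $E$ is $\overline{\mathrm O}$-complete (resp. $\underline{\mathrm O}$-complete, $\mathrm O$-complete) if every increasing (resp. decreasing, monotone) Cauchy sequence in $E$ converges in $E$. $F$ is $\overline{\mathrm O}$-continuous if for every $(x_1,\dots,x_n)\in X^n$ and all sequences $\{x_1^{(m)}\},\dots,\{x_n^{(m)}\}$ in $X$ with $x_i^{(m)}\uparrow x_i$ for each $i$, one has $F(x_1^{(m)},\dots,x_n^{(m)})\to F(x_1,\dots,x_n)$; $\underline{\mathrm O}$-continuity and $\mathrm O$-continuity are defined in the same way with $\uparrow$ replaced by $\downarrow$, resp. by $\uparrow\downarrow$. $(E,d,\preceq)$ has the ICU property if for every sequence $\{x^{(m)}\}$ in $E$ and $x\in E$ with $x^{(m)}\uparrow x$, one has $x^{(m)}\preceq x$ for all $m$; the DCL property if $x^{(m)}\downarrow x$ (in $E$) implies $x^{(m)}\succeq x$ for all $m$; the MCB property if it has both. $F$ has the monotone property if, for all $x_1,\dots,x_n,y_1,\dots,y_n\in X$, $x_i\preceq y_i$ for all $i\in I_n$ implies $F(x_1,\dots,x_n)\preceq F(y_1,\dots,y_n)$. $\Omega$ is the set of functions $\varphi:[0,\infty)\to[0,\infty)$ with $\varphi(t)<t$ and $\limsup_{r\to t^+}\varphi(r)<t$ for each $t>0$. $(x_1,\dots,x_n)\in X^n$ is an $\ast$-fixed point of $F$ if $F(x_{i_1},\dots,x_{i_n})=x_i$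 for each $i\in I_n$. *)

theory Defs
  imports "HOL-Analysis.Analysis"
begin

text \<open>
  The library locale \<open>Metric_space\<close> requires nonnegativity and symmetry of \<open>d\<close> on the whole type,
  and the remaining axioms on the carrier only; every metric on a set \<open>X\<close> extends to such a \<open>d\<close>.
  The order is only constrained on the carrier, so the subspace of \<open>X\<close> on \<open>E\<close> is given by the
  same \<open>d\<close> and \<open>le\<close> with carrier \<open>E\<close>.
\<close>

locale ordered_metric_space = Metric_space X d
  for X :: "'a set" and d :: "'a \<Rightarrow> 'a \<Rightarrow> real" +
  fixes le :: "'a \<Rightarrow> 'a \<Rightarrow> bool"
  assumes nonempty: "X \<noteq> {}"
    and refl_le: "reflp_on X le"
    and trans_le: "transp_on X le"
    and antisym_le: "antisymp_on X le"

definition subspace_of :: "'a set \<Rightarrow> 'a set \<Rightarrow> bool" where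
  "subspace_of E X \<longleftrightarrow> E \<noteq> {} \<and> E \<subseteq> X"

text \<open>
  Tuples are extensional functions on \<open>{1..n}\<close> (value \<open>undefined\<close> outside), so that equality of
  tuples is componentwise equality.
\<close>

definition tuples :: "nat \<Rightarrow> 'a set \<Rightarrow> (nat \<Rightarrow> 'a) set" where
  "tuples n X = ({1..n} \<rightarrow>\<^sub>E X)"

definition tuple_le :: "nat \<Rightarrow> ('a \<Rightarrow> 'a \<Rightarrow> bool) \<Rightarrow> (nat \<Rightarrow> 'a) \<Rightarrow> (nat \<Rightarrow> 'a) \<Rightarrow> bool" where
  "tuple_le n le x y \<longleftrightarrow> (\<forall>i\<in>{1..n}. le (x i) (y i))"

definition comparable :: "nat \<Rightarrow> ('a \<Rightarrow> 'a \<Rightarrow> bool) \<Rightarrow> (nat \<Rightarrow> 'a) \<Rightarrow> (nat \<Rightarrow> 'a) \<Rightarrow> bool" where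
  "comparable n le x y \<longleftrightarrow> tuple_le n le x y \<or> tuple_le n le y x"

definition binops :: "nat \<Rightarrow> (nat \<Rightarrow> nat \<Rightarrow> nat) set" where
  "binops n = {1..n} \<rightarrow> {1..n} \<rightarrow> {1..n}"

text \<open>The \<open>k\<close>-th component is \<open>x\<close> at index \<open>i\<^sub>k = star i k\<close>.\<close>

definition star_tuple :: "nat \<Rightarrow> (nat \<Rightarrow> nat \<Rightarrow> nat) \<Rightarrow> (nat \<Rightarrow> 'a) \<Rightarrow> nat \<Rightarrow> (nat \<Rightarrow> 'a)" where
  "star_tuple n star x i = (\<lambda>k\<in>{1..n}. x (star i k))"

definition star_fixed_point ::
  "nat \<Rightarrow> 'a set \<Rightarrow> (nat \<Rightarrow> nat \<Rightarrow> nat) \<Rightarrow> ((nat \<Rightarrow> 'a) \<Rightarrow> 'a) \<Rightarrow> (nat \<Rightarrow> 'a) \<Rightarrow> bool" where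
  "star_fixed_point n X star F x \<longleftrightarrow>
     x \<in> tuples n X \<and> (\<forall>i\<in>{1..n}. F (star_tuple n star x i) = x i)"

definition increasing_seq :: "('a \<Rightarrow> 'a \<Rightarrow> bool) \<Rightarrow> (nat \<Rightarrow> 'a) \<Rightarrow> bool" where
  "increasing_seq le s \<longleftrightarrow> (\<forall>m. le (s m) (s (Suc m)))"

definition decreasing_seq :: "('a \<Rightarrow> 'a \<Rightarrow> bool) \<Rightarrow> (nat \<Rightarrow> 'a) \<Rightarrow> bool" where
  "decreasing_seq le s \<longleftrightarrow> (\<forall>m. le (s (Suc m)) (s m))"

definition monotone_seq :: "('a \<Rightarrow> 'a \<Rightarrow> bool) \<Rightarrow> (nat \<Rightarrow> 'a) \<Rightarrow> bool" where
  "monotone_seq le s \<longleftrightarrow> increasing_seq le s \<or> decreasing_seq le s"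

definition converges_in :: "'a set \<Rightarrow> ('a \<Rightarrow> 'a \<Rightarrow> real) \<Rightarrow> (nat \<Rightarrow> 'a) \<Rightarrow> 'a \<Rightarrow> bool" where
  "converges_in X d s x \<longleftrightarrow>
     range s \<subseteq> X \<and> limitin (Metric_space.mtopology X d) s x sequentially"

definition upper_O_complete :: "'a set \<Rightarrow> ('a \<Rightarrow> 'a \<Rightarrow> real) \<Rightarrow> ('a \<Rightarrow> 'a \<Rightarrow> bool) \<Rightarrow> bool" where
  "upper_O_complete X d le \<longleftrightarrow>
     (\<forall>s. Metric_space.MCauchy X d s \<and> increasing_seq le s \<longrightarrow> (\<exists>x. converges_in X d s x))"

definition lower_O_complete :: "'a set \<Rightarrow> ('a \<Rightarrow> 'a \<Rightarrow> real) \<Rightarrow> ('a \<Rightarrow> 'a \<Rightarrow> bool) \<Rightarrow> bool" where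
  "lower_O_complete X d le \<longleftrightarrow>
     (\<forall>s. Metric_space.MCauchy X d s \<and> decreasing_seq le s \<longrightarrow> (\<exists>x. converges_in X d s x))"

definition O_complete :: "'a set \<Rightarrow> ('a \<Rightarrow> 'a \<Rightarrow> real) \<Rightarrow> ('a \<Rightarrow> 'a \<Rightarrow> bool) \<Rightarrow> bool" where
  "O_complete X d le \<longleftrightarrow>
     (\<forall>s. Metric_space.MCauchy X d s \<and> monotone_seq le s \<longrightarrow> (\<exists>x. converges_in X d s x))"

text \<open>
  In the continuity notions, \<open>s i\<close> is the sequence in the \<open>i\<close>-th component. In \<open>O_continuous\<close> some
  components may be increasing and others decreasing.
\<close>

definition upper_O_continuous ::
  "nat \<Rightarrow> 'a set \<Rightarrow> ('a \<Rightarrow> 'a \<Rightarrow> real) \<Rightarrow> ('a \<Rightarrow> 'a \<Rightarrow> bool) \<Rightarrow> ((nat \<Rightarrow> 'a) \<Rightarrow> 'a) \<Rightarrow> bool" where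
  "upper_O_continuous n X d le F \<longleftrightarrow>
     (\<forall>x\<in>tuples n X. \<forall>s :: nat \<Rightarrow> nat \<Rightarrow> 'a.
        (\<forall>i\<in>{1..n}. converges_in X d (s i) (x i) \<and> increasing_seq le (s i))
        \<longrightarrow> converges_in X d (\<lambda>m. F (\<lambda>i\<in>{1..n}. s i m)) (F x))"

definition lower_O_continuous ::
  "nat \<Rightarrow> 'a set \<Rightarrow> ('a \<Rightarrow> 'a \<Rightarrow> real) \<Rightarrow> ('a \<Rightarrow> 'a \<Rightarrow> bool) \<Rightarrow> ((nat \<Rightarrow> 'a) \<Rightarrow> 'a) \<Rightarrow> bool" where
  "lower_O_continuous n X d le F \<longleftrightarrow>
     (\<forall>x\<in>tuples n X. \<forall>s :: nat \<Rightarrow> nat \<Rightarrow> 'a.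
        (\<forall>i\<in>{1..n}. converges_in X d (s i) (x i) \<and> decreasing_seq le (s i))
        \<longrightarrow> converges_in X d (\<lambda>m. F (\<lambda>i\<in>{1..n}. s i m)) (F x))"

definition O_continuous ::
  "nat \<Rightarrow> 'a set \<Rightarrow> ('a \<Rightarrow> 'a \<Rightarrow> real) \<Rightarrow> ('a \<Rightarrow> 'a \<Rightarrow> bool) \<Rightarrow> ((nat \<Rightarrow> 'a) \<Rightarrow> 'a) \<Rightarrow> bool" where
  "O_continuous n X d le F \<longleftrightarrow>
     (\<forall>x\<in>tuples n X. \<forall>s :: nat \<Rightarrow> nat \<Rightarrow> 'a.
        (\<forall>i\<in>{1..n}. converges_in X d (s i) (x i) \<and> monotone_seq le (s i))
        \<longrightarrow> converges_in X d (\<lambda>m. F (\<lambda>i\<in>{1..n}. s i m)) (F x))"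

definition ICU :: "'a set \<Rightarrow> ('a \<Rightarrow> 'a \<Rightarrow> real) \<Rightarrow> ('a \<Rightarrow> 'a \<Rightarrow> bool) \<Rightarrow> bool" where
  "ICU X d le \<longleftrightarrow>
     (\<forall>s x. converges_in X d s x \<and> increasing_seq le s \<longrightarrow> (\<forall>m. le (s m) x))"

definition DCL :: "'a set \<Rightarrow> ('a \<Rightarrow> 'a \<Rightarrow> real) \<Rightarrow> ('a \<Rightarrow> 'a \<Rightarrow> bool) \<Rightarrow> bool" where
  "DCL X d le \<longleftrightarrow>
     (\<forall>s x. converges_in X d s x \<and> decreasing_seq le s \<longrightarrow> (\<forall>m. le x (s m)))"

definition MCB :: "'a set \<Rightarrow> ('a \<Rightarrow> 'a \<Rightarrow> real) \<Rightarrow> ('a \<Rightarrow> 'a \<Rightarrow> bool) \<Rightarrow> bool" where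
  "MCB X d le \<longleftrightarrow> ICU X d le \<and> DCL X d le"

definition monotone_property ::
  "nat \<Rightarrow> 'a set \<Rightarrow> ('a \<Rightarrow> 'a \<Rightarrow> bool) \<Rightarrow> ((nat \<Rightarrow> 'a) \<Rightarrow> 'a) \<Rightarrow> bool" where
  "monotone_property n X le F \<longleftrightarrow> monotone_on (tuples n X) (tuple_le n le) le F"

text \<open>
  Functions \<open>[0,\<infinity>) \<rightarrow> [0,\<infinity>)\<close> are represented by functions on the reals whose values at negative
  arguments are irrelevant. The upper limit is taken in the extended reals, so it is always defined.
\<close>

definition Omega :: "(real \<Rightarrow> real) set" where
  "Omega = {\<phi>. (\<forall>t\<ge>0. \<phi> t \<ge> 0) \<and>
     (\<forall>t>0. \<phi> t < t \<and> Limsup (at_right t) (\<lambda>r. ereal (\<phi> r)) < ereal t)}"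

definition mean_contractive ::
  "nat \<Rightarrow> 'a set \<Rightarrow> ('a \<Rightarrow> 'a \<Rightarrow> real) \<Rightarrow> ('a \<Rightarrow> 'a \<Rightarrow> bool) \<Rightarrow> (nat \<Rightarrow> nat \<Rightarrow> nat) \<Rightarrow>
   ((nat \<Rightarrow> 'a) \<Rightarrow> 'a) \<Rightarrow> (real \<Rightarrow> real) \<Rightarrow> bool" where
  "mean_contractive n X d le star F \<phi> \<longleftrightarrow>
     (\<forall>x\<in>tuples n X. \<forall>y\<in>tuples n X. comparable n le x y \<longrightarrow>
        (1 / real n) * (\<Sum>i=1..n. d (F (star_tuple n star x i)) (F (star_tuple n star y i)))
        \<le> \<phi> ((1 / real n) * (\<Sum>i=1..n. d (x i) (y i))))"

definition max_contractive ::
  "nat \<Rightarrow> 'a set \<Rightarrow> ('a \<Rightarrow> 'a \<Rightarrow> real) \<Rightarrow> ('a \<Rightarrow> 'a \<Rightarrow> bool) \<Rightarrow> (nat \<Rightarrow> nat \<Rightarrow> nat) \<Rightarrow>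
   ((nat \<Rightarrow> 'a) \<Rightarrow> 'a) \<Rightarrow> (real \<Rightarrow> real) \<Rightarrow> bool" where
  "max_contractive n X d le star F \<phi> \<longleftrightarrow>
     (\<forall>x\<in>tuples n X. \<forall>y\<in>tuples n X. comparable n le x y \<longrightarrow>
        (MAX i\<in>{1..n}. d (F (star_tuple n star x i)) (F (star_tuple n star y i)))
        \<le> \<phi> (MAX i\<in>{1..n}. d (x i) (y i)))"

end

theory Submission
  imports Defs
begin

text \<open>
  A \<open>*\<close>-fixed point of \<open>F\<close> is a fixed point of the map \<open>\<Phi>\<close> on tuples whose \<open>i\<close>-th component is
  \<open>x \<mapsto> F (x\<^sub>i\<^sub>1, \<dots>, x\<^sub>i\<^sub>n)\<close>. This map is monotone for the componentwise order, and each of the two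
  contractivity hypotheses is a one-variable condition \<open>D (\<Phi> x) (\<Phi> y) \<le> \<phi> (D x y)\<close> for comparable
  \<open>x\<close> and \<open>y\<close>, where \<open>D\<close> is the mean or the maximum metric on tuples. So the claim is a fixed point
  theorem for monotone maps that contract comparable pairs.
  
  The comparison function \<open>\<phi>\<close> enters only through a Meir--Keeler condition: for each \<open>\<epsilon> > 0\<close>
  there is \<open>\<delta> > 0\<close> such that \<open>\<phi> r < \<epsilon>\<close> for \<open>0 < r < \<epsilon> + \<delta>\<close> (\<open>Omega_Meir_Keeler\<close>). From it follow,
  with no subsequence argument, that the iterates of comparable points approach each other
  (\<open>iterates_approach\<close>) and that an orbit which stays comparable to its starting point is Cauchy
  (\<open>orbit_MCauchy\<close>).
  
  For existence, an initial tuple below its image has an increasing orbit. From the first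
  iterate on, its components lie in \<open>E\<close> and are Cauchy there, so they converge to the
  components of a tuple \<open>x\<close>. Either continuity of \<open>F\<close> gives \<open>\<Phi> x = x\<close> directly, or the orbit stays
  below \<open>x\<close>, so that the contraction applies to each iterate and \<open>x\<close> and shows that the orbit also
  converges to \<open>\<Phi> x\<close> (\<open>fixed_point_exists\<close>). For uniqueness, if \<open>z\<close> is comparable to two fixed
  points, the orbit of \<open>z\<close> approaches both, so they coincide (\<open>fixed_points_equal\<close>). Decreasing
  orbits are increasing ones for the reversed order, and the two-sided hypotheses imply the
  one-sided ones in both directions.
\<close>

section \<open>Comparison functions are of Meir--Keeler type\<close>

text \<open>
  For \<open>r\<close> slightly above \<open>\<epsilon>\<close> this is the upper limit condition at \<open>\<epsilon>\<close>; for \<open>r \<le> \<epsilon>\<close> it is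
  \<open>\<phi> r < r\<close>. The value \<open>\<phi> 0\<close> may be positive, hence the restriction to \<open>r > 0\<close>.
\<close>

lemma Omega_Meir_Keeler:
  assumes phi: "\<phi> \<in> Omega" and "0 < \<epsilon>"
  obtains \<delta> where "0 < \<delta>" "\<And>r. 0 < r \<Longrightarrow> r < \<epsilon> + \<delta> \<Longrightarrow> \<phi> r < \<epsilon>"
proof -
  have below: "\<phi> r < r" if "0 < r" for r
    using phi that by (auto simp: Omega_def)
  have "Limsup (at_right \<epsilon>) (\<lambda>r. ereal (\<phi> r)) < ereal \<epsilon>"
    using phi \<open>0 < \<epsilon>\<close> by (auto simp: Omega_def)
  then have "eventually (\<lambda>r. \<phi> r < \<epsilon>) (at_right \<epsilon>)"
    using Limsup_lessD by fastforce
  then obtain b where b: "\<epsilon> < b" "\<And>r. \<epsilon> < r \<Longrightarrow> r < b \<Longrightarrow> \<phi> r < \<epsilon>"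
    by (auto simp: eventually_at_right_field)
  show thesis
  proof
    show "0 < b - \<epsilon>" using b by simp
    show "\<phi> r < \<epsilon>" if "0 < r" "r < \<epsilon> + (b - \<epsilon>)" for r
      using that below[of r] below[of \<epsilon>] b(2)[of r] by (cases r \<epsilon> rule: linorder_cases) auto
  qed
qed

section \<open>Meir--Keeler contractions on related pairs\<close>

text \<open>
  The intended \<open>R\<close> is comparability in an order. It is not transitive, so the results below assume
  it for the particular pairs that they compare.
\<close>

locale related_contraction = Metric_space M d
  for M :: "'b set" and d +
  fixes T :: "'b \<Rightarrow> 'b" and R :: "'b \<Rightarrow> 'b \<Rightarrow> bool"
  assumes T_closed: "x \<in> M \<Longrightarrow> T x \<in> M"
    and T_related: "x \<in> M \<Longrightarrow> y \<in> M \<Longrightarrow> R x y \<Longrightarrow> R (T x) (T y)"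
    and Meir_Keeler: "0 < \<epsilon> \<Longrightarrow> \<exists>\<delta>>0. \<forall>x\<in>M. \<forall>y\<in>M. R x y \<longrightarrow> d x y < \<epsilon> + \<delta> \<longrightarrow> d (T x) (T y) < \<epsilon>"
begin

lemma iterate_closed: "x \<in> M \<Longrightarrow> (T ^^ m) x \<in> M"
  by (induction m) (auto simp: T_closed)

lemma iterates_related:
  "x \<in> M \<Longrightarrow> y \<in> M \<Longrightarrow> R x y \<Longrightarrow> R ((T ^^ m) x) ((T ^^ m) y)"
  by (induction m) (auto simp: T_related iterate_closed)

text \<open>
  Every \<open>\<epsilon>\<close> above \<open>d x y\<close> is, by the Meir--Keeler condition at that \<open>\<epsilon>\<close>, a bound for the images.
\<close>

lemma nonexpansive:
  assumes "x \<in> M" "y \<in> M" "R x y"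
  shows "d (T x) (T y) \<le> d x y"
proof (rule dense_ge)
  fix \<epsilon> assume "d x y < \<epsilon>"
  moreover have "0 < \<epsilon>" using calculation nonneg[of x y] by linarith
  ultimately show "d (T x) (T y) \<le> \<epsilon>"
    using Meir_Keeler[of \<epsilon>] assms by force
qed

text \<open>
  The distances decrease to some limit \<open>t\<close>. If \<open>t\<close> were positive, the Meir--Keeler condition at \<open>t\<close>
  would push a distance that is already close to \<open>t\<close> below \<open>t\<close> in one step.
\<close>

lemma iterates_approach:
  assumes "x \<in> M" "y \<in> M" "R x y"
  shows "(\<lambda>m. d ((T ^^ m) x) ((T ^^ m) y)) \<longlonglongrightarrow> 0"
proof -
  define a where "a = (\<lambda>m. d ((T ^^ m) x) ((T ^^ m) y))"
  have step: "R ((T ^^ m) x) ((T ^^ m) y)" "(T ^^ m) x \<in> M" "(T ^^ m) y \<in> M" for m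
    using assms by (auto simp: iterates_related iterate_closed)
  have "decseq a"
    by (auto simp: a_def decseq_Suc_iff intro: nonexpansive step)
  then obtain t where t: "a \<longlonglongrightarrow> t" "\<And>m. t \<le> a m"
    using decseq_convergent[of a 0] by (auto simp: a_def)
  have "0 \<le> t"
    using t(1) by (rule LIMSEQ_le_const) (auto simp: a_def)
  moreover have False if "0 < t"
  proof -
    obtain \<delta> where \<delta>: "0 < \<delta>"
      "\<And>x y. x \<in> M \<Longrightarrow> y \<in> M \<Longrightarrow> R x y \<Longrightarrow> d x y < t + \<delta> \<Longrightarrow> d (T x) (T y) < t"
      using Meir_Keeler[OF \<open>0 < t\<close>] by blast
    have "eventually (\<lambda>m. a m < t + \<delta>) sequentially"
      using \<delta>(1) by (intro order_tendstoD(2)[OF t(1)]) simp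
    then obtain m where "a m < t + \<delta>"
      by (auto simp: eventually_sequentially)
    then have "a (Suc m) < t"
      using \<delta>(2) step by (auto simp: a_def)
    with t(2)[of "Suc m"] show False by simp
  qed
  ultimately have "t = 0" by force
  with t(1) show ?thesis by (simp add: a_def)
qed

text \<open>
  A relation of \<open>x\<close> to its own iterates carries over to any two members of the orbit, so the
  contraction applies to all such pairs. Once consecutive distances are below \<open>\<delta>\<close>, a ball
  of radius \<open>\<epsilon>/2 + \<delta>\<close> around \<open>T\<^sup>m x\<close> traps the rest of the orbit: a later iterate in that ball
  is mapped to within \<open>\<epsilon>/2\<close> of \<open>T\<^sup>m\<^sup>+\<^sup>1 x\<close>, hence to within \<open>\<epsilon>/2 + \<delta>\<close> of \<open>T\<^sup>m x\<close>.
\<close>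

lemma orbit_MCauchy:
  assumes x: "x \<in> M" and R: "\<And>m. R x ((T ^^ m) x)"
  shows "MCauchy (\<lambda>m. (T ^^ m) x)"
proof -
  let ?s = "\<lambda>m. (T ^^ m) x"
  have s: "?s m \<in> M" for m using x by (rule iterate_closed)
  have rel: "R (?s m) (?s (m + k))" for m k
    using iterates_related[OF x iterate_closed[OF x] R[of k], of m] by (simp add: funpow_add)
  have "\<exists>N. \<forall>m\<ge>N. \<forall>k. d (?s m) (?s (m + k)) < \<epsilon>" if "0 < \<epsilon>" for \<epsilon>
  proof -
    obtain \<delta>0 where \<delta>0: "0 < \<delta>0"
      "\<And>x y. x \<in> M \<Longrightarrow> y \<in> M \<Longrightarrow> R x y \<Longrightarrow> d x y < \<epsilon>/2 + \<delta>0 \<Longrightarrow> d (T x) (T y) < \<epsilon>/2"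
      using Meir_Keeler[OF half_gt_zero[OF \<open>0 < \<epsilon>\<close>]] by blast
    \<comment> \<open>Shrinking keeps the trapping radius \<open>\<epsilon>/2 + \<delta>\<close> at most \<open>\<epsilon>\<close>.\<close>
    define \<delta> where "\<delta> = min \<delta>0 (\<epsilon>/2)"
    have "0 < \<delta>" using \<delta>0(1) that by (simp add: \<delta>_def)
    have "(\<lambda>m. d (?s m) (?s (Suc m))) \<longlonglongrightarrow> 0"
      using iterates_approach[OF x iterate_closed[OF x] R[of 1]] by (simp add: funpow_swap1)
    then have "eventually (\<lambda>m. d (?s m) (?s (Suc m)) < \<delta>) sequentially"
      using \<open>0 < \<delta>\<close> by (rule order_tendstoD)
    then obtain N where N: "\<And>m. N \<le> m \<Longrightarrow> d (?s m) (?s (Suc m)) < \<delta>"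
      by (auto simp: eventually_sequentially)
    have "d (?s m) (?s (m + k)) < \<epsilon>/2 + \<delta>" if "N \<le> m" for m k
    proof (induction k)
      case 0
      show ?case using s \<open>0 < \<epsilon>\<close> \<open>0 < \<delta>\<close> by simp
    next
      case (Suc k)
      have "d (?s (Suc m)) (?s (m + Suc k)) < \<epsilon>/2"
        using \<delta>0(2)[OF s s rel, of m k] Suc by (simp add: \<delta>_def)
      then show ?case
        using triangle[OF s s s, of m "m + Suc k" "Suc m"] N[OF \<open>N \<le> m\<close>] by linarith
    qed
    moreover have "\<epsilon>/2 + \<delta> \<le> \<epsilon>" by (simp add: \<delta>_def)
    ultimately show ?thesis by (meson less_le_trans)
  qed
  then have "\<exists>N. \<forall>m m'. N \<le> m \<longrightarrow> N \<le> m' \<longrightarrow> d (?s m) (?s m') < \<epsilon>" if "0 < \<epsilon>" for \<epsilon>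
    using that by (metis commute le_Suc_ex nat_le_linear)
  then show ?thesis using s by (auto simp: MCauchy_def)
qed

text \<open>
  The orbit of \<open>z\<close> approaches both fixed points.
\<close>

lemma fixed_points_equal:
  assumes "x \<in> M" "T x = x" "y \<in> M" "T y = y" "z \<in> M" "R z x" "R z y"
  shows "x = y"
proof -
  have fixed: "(T ^^ m) x = x" "(T ^^ m) y = y" for m
    using assms by (induction m) auto
  have "(\<lambda>m. d ((T ^^ m) z) x + d ((T ^^ m) z) y) \<longlonglongrightarrow> 0 + 0"
    using iterates_approach[of z x] iterates_approach[of z y] assms fixed
    by (intro tendsto_add) auto
  moreover have "d x y \<le> d ((T ^^ m) z) x + d ((T ^^ m) z) y" for m
    using triangle[of x "(T ^^ m) z" y] iterate_closed[of z m] assms by (simp add: commute)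
  ultimately have "d x y \<le> 0"
    by (intro LIMSEQ_le_const) auto
  then show ?thesis
    using assms nonneg[of x y] by (simp add: zero)
qed

end

section \<open>The map induced on tuples\<close>

definition star_map ::
  "nat \<Rightarrow> (nat \<Rightarrow> nat \<Rightarrow> nat) \<Rightarrow> ((nat \<Rightarrow> 'a) \<Rightarrow> 'a) \<Rightarrow> (nat \<Rightarrow> 'a) \<Rightarrow> nat \<Rightarrow> 'a" where
  "star_map n star F x = (\<lambda>i\<in>{1..n}. F (star_tuple n star x i))"

lemma star_index:
  assumes "star \<in> binops n" "i \<in> {1..n}" "k \<in> {1..n}"
  shows "star i k \<in> {1..n}"
  using assms unfolding binops_def by (metis Pi_mem)

lemma star_tuple_closed:
  assumes "star \<in> binops n" "x \<in> tuples n X" "i \<in> {1..n}"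
  shows "star_tuple n star x i \<in> tuples n X"
  unfolding tuples_def star_tuple_def restrict_PiE_iff
proof
  fix k assume "k \<in> {1..n}"
  then have "star i k \<in> {1..n}" by (rule star_index[OF assms(1,3)])
  then show "x (star i k) \<in> X" by (rule PiE_mem[OF assms(2)[unfolded tuples_def]])
qed

lemma star_map_closed:
  assumes "star \<in> binops n" "F ` tuples n X \<subseteq> Y" "x \<in> tuples n X"
  shows "star_map n star F x \<in> tuples n Y"
  unfolding tuples_def star_map_def restrict_PiE_iff
  using star_tuple_closed[OF assms(1,3)] assms(2) by auto

lemma converges_in_iff:
  assumes "Metric_space X d"
  shows "converges_in X d s x \<longleftrightarrow> range s \<subseteq> X \<and> x \<in> X \<and> (\<lambda>m. d (s m) x) \<longlonglongrightarrow> 0"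
proof -
  interpret Metric_space X d by fact
  show ?thesis
    unfolding converges_in_def limitin_metric_dist_null
    by (metis (no_types, lifting) UNIV_I eventuallyI image_subset_iff)
qed

text \<open>
  The metric \<open>D\<close> on tuples is left open so that the mean and the maximum metric are treated at
  once. The two comparison inequalities make \<open>D\<close>-convergence equivalent to componentwise
  convergence; the factor \<open>n\<close> is what the mean metric needs.
\<close>

locale star_contraction = ordered_metric_space X d le
  for X :: "'a set" and d and le +
  fixes n :: nat and E :: "'a set" and star :: "nat \<Rightarrow> nat \<Rightarrow> nat"
    and F :: "(nat \<Rightarrow> 'a) \<Rightarrow> 'a" and D :: "(nat \<Rightarrow> 'a) \<Rightarrow> (nat \<Rightarrow> 'a) \<Rightarrow> real"
  assumes star: "star \<in> binops n"
    and subspace_E: "subspace_of E X"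
    and F_range: "F ` tuples n X \<subseteq> E"
    and F_mono: "monotone_property n X le F"
    and tuple_metric: "Metric_space (tuples n X) D"
    and component_le: "i \<in> {1..n} \<Longrightarrow> d (x i) (y i) \<le> real n * D x y"
    and le_component_sum: "D x y \<le> (\<Sum>i=1..n. d (x i) (y i))"
    and Meir_Keeler: "0 < \<epsilon> \<Longrightarrow> \<exists>\<delta>>0. \<forall>x\<in>tuples n X. \<forall>y\<in>tuples n X.
      comparable n le x y \<longrightarrow> D x y < \<epsilon> + \<delta> \<longrightarrow> D (star_map n star F x) (star_map n star F y) < \<epsilon>"
begin

abbreviation "Phi \<equiv> star_map n star F"

lemma E_subset: "E \<subseteq> X"
  using subspace_E by (simp add: subspace_of_def)

lemma Phi_component: "i \<in> {1..n} \<Longrightarrow> Phi x i = F (star_tuple n star x i)"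
  by (simp add: star_map_def)

lemma Phi_in_E: "x \<in> tuples n X \<Longrightarrow> i \<in> {1..n} \<Longrightarrow> Phi x i \<in> E"
  using F_range star_tuple_closed[OF star, of x X i] by (auto simp: Phi_component)

lemma Phi_closed: "x \<in> tuples n X \<Longrightarrow> Phi x \<in> tuples n X"
  using star_map_closed[OF star subset_trans[OF F_range E_subset]] .

lemma Phi_mono:
  assumes "x \<in> tuples n X" "y \<in> tuples n X" "tuple_le n le x y"
  shows "tuple_le n le (Phi x) (Phi y)"
  unfolding tuple_le_def
proof
  fix i assume i: "i \<in> {1..n}"
  have "tuple_le n le (star_tuple n star x i) (star_tuple n star y i)"
    using assms(3) star_index[OF star i] by (simp add: tuple_le_def star_tuple_def)
  then show "le (Phi x i) (Phi y i)"
    using F_mono star_tuple_closed[OF star assms(1) i] star_tuple_closed[OF star assms(2) i]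
    unfolding Phi_component[OF i] monotone_property_def by (blast dest: monotone_onD)
qed

lemma tuple_le_trans:
  assumes "x \<in> tuples n X" "y \<in> tuples n X" "z \<in> tuples n X"
    and "tuple_le n le x y" "tuple_le n le y z"
  shows "tuple_le n le x z"
  unfolding tuple_le_def
proof
  fix i assume i: "i \<in> {1..n}"
  then have "x i \<in> X" "y i \<in> X" "z i \<in> X" "le (x i) (y i)" "le (y i) (z i)"
    using assms by (auto simp: tuples_def tuple_le_def)
  then show "le (x i) (z i)"
    using trans_le by (meson transp_onD)
qed

sublocale tup: related_contraction "tuples n X" D Phi "comparable n le"
proof -
  interpret T: Metric_space "tuples n X" D by (rule tuple_metric)
  show "related_contraction (tuples n X) D Phi (comparable n le)"
    by unfold_locales (use Phi_closed Phi_mono Meir_Keeler in \<open>auto simp: comparable_def\<close>)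
qed

lemma star_fixed_point_iff: "star_fixed_point n X star F x \<longleftrightarrow> x \<in> tuples n X \<and> Phi x = x"
proof -
  have "(\<forall>i\<in>{1..n}. Phi x i = x i) \<longleftrightarrow> Phi x = x" if "x \<in> tuples n X"
    using Phi_closed[OF that] that unfolding tuples_def by (metis PiE_ext)
  then show ?thesis
    by (auto simp: star_fixed_point_def Phi_component)
qed

text \<open>
  The limit of the orbit \<open>u\<close> is built componentwise in \<open>E\<close>, because completeness is a hypothesis
  on \<open>E\<close> only. It is a fixed point because \<open>u\<close> converges componentwise both to it and to its image.
\<close>

lemma fixed_point_exists:
  assumes complete: "upper_O_complete E d le"
    and limit: "upper_O_continuous n X d le F \<or> ICU E d le"
    and x0: "x0 \<in> tuples n X" and start: "tuple_le n le x0 (Phi x0)"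
  shows "\<exists>x\<in>tuples n X. Phi x = x"
proof -
  define u where "u = (\<lambda>m. (Phi ^^ m) x0)"
  have u: "u m \<in> tuples n X" for m
    using tup.iterate_closed[OF x0] by (simp add: u_def)
  have u_Suc: "u (Suc m) = Phi (u m)" for m by (simp add: u_def)
  have u_le: "tuple_le n le (u m) (u (Suc m))" for m
  proof (induction m)
    case 0
    show ?case using start by (simp add: u_def)
  next
    case (Suc m)
    then show ?case using Phi_mono u u_Suc by metis
  qed
  have "tuple_le n le (u 0) (u m)" for m
  proof (induction m)
    case 0
    have "le (x0 i) (x0 i)" if "i \<in> {1..n}" for i
      using refl_le x0 that by (auto simp: reflp_on_def tuples_def)
    then show ?case by (simp add: u_def tuple_le_def)
  next
    case (Suc m)
    then show ?case using tuple_le_trans u u_le by blast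
  qed
  then have "comparable n le x0 ((Phi ^^ m) x0)" for m
    by (simp add: u_def comparable_def)
  then have Cauchy: "tup.MCauchy u"
    using tup.orbit_MCauchy[OF x0] by (simp add: u_def)

  have E: "Metric_space E d" using E_subset by (rule subspace)
  interpret ME: Metric_space E d by (rule E)
  \<comment> \<open>The initial tuple itself need not lie in \<open>E\<close>, so the orbit is used from index 1 on.\<close>
  have in_E: "u (Suc m) i \<in> E" if "i \<in> {1..n}" for m i
    using Phi_in_E[OF u that] by (simp add: u_Suc)
  have "\<exists>l. converges_in E d (\<lambda>m. u (Suc m) i) l" if i: "i \<in> {1..n}" for i
  proof -
    have "\<exists>N. \<forall>m m'. N \<le> m \<longrightarrow> N \<le> m' \<longrightarrow> d (u (Suc m) i) (u (Suc m') i) < \<epsilon>"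
      if "0 < \<epsilon>" for \<epsilon>
    proof -
      have n: "0 < real n" using i by simp
      then have "0 < \<epsilon> / real n" using that by simp
      then obtain N where N: "\<And>m m'. N \<le> m \<Longrightarrow> N \<le> m' \<Longrightarrow> D (u m) (u m') < \<epsilon> / real n"
        using Cauchy unfolding tup.MCauchy_def by meson
      have "d (u (Suc m) i) (u (Suc m') i) < \<epsilon>" if "N \<le> m" "N \<le> m'" for m m'
      proof -
        have "real n * D (u (Suc m)) (u (Suc m')) < \<epsilon>"
          using N[of "Suc m" "Suc m'"] that n by (simp add: field_simps)
        then show ?thesis using component_le[OF i] le_less_trans by blast
      qed
      then show ?thesis by blast
    qed
    then have "ME.MCauchy (\<lambda>m. u (Suc m) i)"
      using in_E[OF i] by (auto simp: ME.MCauchy_def)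
    moreover have "increasing_seq le (\<lambda>m. u (Suc m) i)"
      using u_le i by (auto simp: increasing_seq_def tuple_le_def)
    ultimately show ?thesis
      using complete by (auto simp: upper_O_complete_def)
  qed
  then obtain l where l: "\<And>i. i \<in> {1..n} \<Longrightarrow> converges_in E d (\<lambda>m. u (Suc m) i) (l i)"
    by metis
  define x where "x = (\<lambda>i\<in>{1..n}. l i)"
  have conv_E: "converges_in E d (\<lambda>m. u (Suc m) i) (x i)" if "i \<in> {1..n}" for i
    using l[OF that] that by (simp add: x_def)
  have x: "x \<in> tuples n X"
    using conv_E E_subset by (auto simp: tuples_def x_def converges_in_iff[OF E])
  have conv_X: "converges_in X d (\<lambda>m. u (Suc m) i) (x i)" if "i \<in> {1..n}" for i
    using conv_E[OF that] E_subset
    by (auto simp: converges_in_iff[OF E] converges_in_iff[OF Metric_space_axioms])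
  have incr: "increasing_seq le (\<lambda>m. u (Suc m) i)" if "i \<in> {1..n}" for i
    using u_le that by (auto simp: increasing_seq_def tuple_le_def)

  \<comment> \<open>Under \<open>ICU\<close> the iterates are comparable to \<open>x\<close>, so that \<open>Phi\<close> is nonexpansive on these pairs
    and carries the convergence to \<open>x\<close> over to the images.\<close>
  have "converges_in X d (\<lambda>m. u (Suc (Suc m)) i) (Phi x i)" if i: "i \<in> {1..n}" for i
    using limit
  proof
    assume cont: "upper_O_continuous n X d le F"
    have "converges_in X d (\<lambda>m. F (\<lambda>k\<in>{1..n}. u (Suc m) (star i k))) (F (star_tuple n star x i))"
      using cont[unfolded upper_O_continuous_def, rule_format,
          OF star_tuple_closed[OF star x i], of "\<lambda>k m. u (Suc m) (star i k)"]
        conv_X incr star_index[OF star i]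
      by (simp add: star_tuple_def)
    then show ?thesis
      using i by (simp add: u_Suc[of "Suc _"] Phi_component star_tuple_def)
  next
    assume "ICU E d le"
    then have "le (u (Suc m) j) (x j)" if "j \<in> {1..n}" for j m
      using conv_E[OF that] incr[OF that] by (auto simp: ICU_def)
    then have comp: "comparable n le (u (Suc m)) x" for m
      by (simp add: comparable_def tuple_le_def)
    have bound: "d (u (Suc (Suc m)) i) (Phi x i) \<le> real n * (\<Sum>j=1..n. d (u (Suc m) j) (x j))" for m
    proof -
      have "d (u (Suc (Suc m)) i) (Phi x i) \<le> real n * D (Phi (u (Suc m))) (Phi x)"
        using component_le[OF i, of "Phi (u (Suc m))" "Phi x"] by (simp add: u_Suc[of "Suc _"])
      also have "\<dots> \<le> real n * D (u (Suc m)) x"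
        using tup.nonexpansive[OF u x comp] by (intro mult_left_mono) auto
      also have "\<dots> \<le> real n * (\<Sum>j=1..n. d (u (Suc m) j) (x j))"
        by (intro mult_left_mono le_component_sum) auto
      finally show ?thesis .
    qed
    have "(\<lambda>m. \<Sum>j=1..n. d (u (Suc m) j) (x j)) \<longlonglongrightarrow> (\<Sum>j=1..n. 0)"
      using conv_X by (intro tendsto_sum) (auto simp: converges_in_iff[OF Metric_space_axioms])
    then have "(\<lambda>m. real n * (\<Sum>j=1..n. d (u (Suc m) j) (x j))) \<longlonglongrightarrow> 0"
      by (intro tendsto_mult_right_zero) simp
    then have "(\<lambda>m. d (u (Suc (Suc m)) i) (Phi x i)) \<longlonglongrightarrow> 0"
      by (rule real_tendsto_sandwich[OF _ _ tendsto_const, rotated 2]) (use bound in simp_all)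
    then show ?thesis
      using in_E[OF i] Phi_in_E[OF x i] E_subset
      by (auto simp: converges_in_iff[OF Metric_space_axioms])
  qed
  moreover have "converges_in X d (\<lambda>m. u (Suc (Suc m)) i) (x i)" if "i \<in> {1..n}" for i
    using conv_X[OF that] LIMSEQ_Suc[of "\<lambda>m. d (u (Suc m) i) (x i)" 0]
    by (auto simp: converges_in_iff[OF Metric_space_axioms])
  ultimately have "Phi x i = x i" if "i \<in> {1..n}" for i
    using that limitin_metric_unique[OF _ _ trivial_limit_sequentially]
    by (fastforce simp: converges_in_def)
  then have "Phi x = x"
    using star_fixed_point_iff[of x] x by (simp add: star_fixed_point_def Phi_component)
  with x show ?thesis by blast
qed

lemma unique_star_fixed_point:
  assumes "upper_O_complete E d le"
    and "upper_O_continuous n X d le F \<or> ICU E d le"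
    and "\<exists>x0\<in>tuples n X. \<forall>i\<in>{1..n}. le (x0 i) (F (star_tuple n star x0 i))"
    and joined: "\<forall>x\<in>tuples n X. \<forall>y\<in>tuples n X.
      \<exists>z\<in>tuples n X. comparable n le z x \<and> comparable n le z y"
  shows "\<exists>!x. star_fixed_point n X star F x"
proof (rule ex_ex1I)
  obtain x0 where "x0 \<in> tuples n X" "tuple_le n le x0 (Phi x0)"
    using assms(3) by (auto simp: tuple_le_def Phi_component)
  then show "\<exists>x. star_fixed_point n X star F x"
    using fixed_point_exists[OF assms(1,2)] by (auto simp: star_fixed_point_iff)
next
  fix x y assume "star_fixed_point n X star F x" "star_fixed_point n X star F y"
  then show "x = y"
    using joined tup.fixed_points_equal[of x y] by (meson star_fixed_point_iff)
qed

end

section \<open>The mean and the maximum metric on tuples\<close>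

definition mean_dist :: "nat \<Rightarrow> ('a \<Rightarrow> 'a \<Rightarrow> real) \<Rightarrow> (nat \<Rightarrow> 'a) \<Rightarrow> (nat \<Rightarrow> 'a) \<Rightarrow> real" where
  "mean_dist n d x y = (1 / real n) * (\<Sum>i=1..n. d (x i) (y i))"

definition max_dist :: "nat \<Rightarrow> ('a \<Rightarrow> 'a \<Rightarrow> real) \<Rightarrow> (nat \<Rightarrow> 'a) \<Rightarrow> (nat \<Rightarrow> 'a) \<Rightarrow> real" where
  "max_dist n d x y = (MAX i\<in>{1..n}. d (x i) (y i))"

context Metric_space
begin

lemma tuples_eq_iff:
  assumes "x \<in> tuples n M" "y \<in> tuples n M"
  shows "x = y \<longleftrightarrow> (\<forall>i\<in>{1..n}. d (x i) (y i) = 0)"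
proof -
  have "d (x i) (y i) = 0 \<longleftrightarrow> x i = y i" if "i \<in> {1..n}" for i
    using assms that by (intro zero) (auto simp: tuples_def)
  moreover have "x = y \<longleftrightarrow> (\<forall>i\<in>{1..n}. x i = y i)"
    using assms unfolding tuples_def by (metis PiE_ext)
  ultimately show ?thesis by blast
qed

lemma Metric_space_mean_dist:
  assumes "0 < n"
  shows "Metric_space (tuples n M) (mean_dist n d)"
proof
  fix x y show "0 \<le> mean_dist n d x y" by (simp add: mean_dist_def sum_nonneg)
  show "mean_dist n d x y = mean_dist n d y x" by (simp add: mean_dist_def commute)
next
  fix x y assume xy: "x \<in> tuples n M" "y \<in> tuples n M"
  have "mean_dist n d x y = 0 \<longleftrightarrow> (\<Sum>i=1..n. d (x i) (y i)) = 0"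
    using assms by (simp add: mean_dist_def)
  also have "\<dots> \<longleftrightarrow> (\<forall>i\<in>{1..n}. d (x i) (y i) = 0)"
    by (rule sum_nonneg_eq_0_iff) simp_all
  also have "\<dots> \<longleftrightarrow> x = y"
    by (rule tuples_eq_iff[OF xy, symmetric])
  finally show "mean_dist n d x y = 0 \<longleftrightarrow> x = y" .
next
  fix x y z assume "x \<in> tuples n M" "y \<in> tuples n M" "z \<in> tuples n M"
  then have "(\<Sum>i=1..n. d (x i) (z i)) \<le> (\<Sum>i=1..n. d (x i) (y i) + d (y i) (z i))"
    by (intro sum_mono triangle) (auto simp: tuples_def)
  then show "mean_dist n d x z \<le> mean_dist n d x y + mean_dist n d y z"
    by (simp add: mean_dist_def sum.distrib divide_right_mono flip: add_divide_distrib)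
qed

lemma Metric_space_max_dist:
  assumes "0 < n"
  shows "Metric_space (tuples n M) (max_dist n d)"
proof
  have ne: "{1..n} \<noteq> {}" using assms by simp
  have le_iff: "max_dist n d x y \<le> c \<longleftrightarrow> (\<forall>i\<in>{1..n}. d (x i) (y i) \<le> c)" for x y c
    using ne by (simp add: max_dist_def)
  have ge: "d (x i) (y i) \<le> max_dist n d x y" if "i \<in> {1..n}" for x y i
    using that le_iff by blast
  show nonneg': "0 \<le> max_dist n d x y" for x y
    using order_trans[OF nonneg ge[of 1 x y]] assms by simp
  show "max_dist n d x y = max_dist n d y x" for x y by (simp add: max_dist_def commute)
  show "max_dist n d x y = 0 \<longleftrightarrow> x = y" if "x \<in> tuples n M" "y \<in> tuples n M" for x y
    using tuples_eq_iff[OF that] le_iff[of x y 0] nonneg'[of x y] by (auto simp: order_antisym)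
  show "max_dist n d x z \<le> max_dist n d x y + max_dist n d y z"
    if "x \<in> tuples n M" "y \<in> tuples n M" "z \<in> tuples n M" for x y z
    unfolding le_iff
  proof
    fix i assume i: "i \<in> {1..n}"
    then have "d (x i) (z i) \<le> d (x i) (y i) + d (y i) (z i)"
      using that by (intro triangle) (auto simp: tuples_def)
    then show "d (x i) (z i) \<le> max_dist n d x y + max_dist n d y z"
      using ge[OF i, of x y] ge[OF i, of y z] by linarith
  qed
qed

lemma mean_dist_bounds:
  assumes "0 < n"
  shows "i \<in> {1..n} \<Longrightarrow> d (x i) (y i) \<le> real n * mean_dist n d x y"
    and "mean_dist n d x y \<le> (\<Sum>i=1..n. d (x i) (y i))"
proof -
  show "i \<in> {1..n} \<Longrightarrow> d (x i) (y i) \<le> real n * mean_dist n d x y"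
    using assms member_le_sum[of i "{1..n}" "\<lambda>i. d (x i) (y i)"] by (simp add: mean_dist_def)
  have "0 \<le> (\<Sum>i=1..n. d (x i) (y i))" by (simp add: sum_nonneg)
  then have "(1 / real n) * (\<Sum>i=1..n. d (x i) (y i)) \<le> 1 * (\<Sum>i=1..n. d (x i) (y i))"
    using assms by (intro mult_right_mono) auto
  then show "mean_dist n d x y \<le> (\<Sum>i=1..n. d (x i) (y i))" by (simp add: mean_dist_def)
qed

lemma max_dist_bounds:
  assumes "0 < n"
  shows "i \<in> {1..n} \<Longrightarrow> d (x i) (y i) \<le> real n * max_dist n d x y"
    and "max_dist n d x y \<le> (\<Sum>i=1..n. d (x i) (y i))"
proof -
  show "d (x i) (y i) \<le> real n * max_dist n d x y" if "i \<in> {1..n}"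
  proof -
    have le: "d (x i) (y i) \<le> max_dist n d x y" using that by (simp add: max_dist_def)
    moreover have "0 \<le> max_dist n d x y" using le nonneg[of "x i" "y i"] by linarith
    then have "1 * max_dist n d x y \<le> real n * max_dist n d x y"
      using assms by (intro mult_right_mono) auto
    ultimately show ?thesis by simp
  qed
  show "max_dist n d x y \<le> (\<Sum>i=1..n. d (x i) (y i))"
    using assms by (auto simp: max_dist_def intro!: member_le_sum)
qed

end

text \<open>
  A contraction bound through \<open>\<phi>\<close> gives the Meir--Keeler condition. Pairs at distance \<open>0\<close>, where
  \<open>\<phi>\<close> gives no information, consist of equal points and so have equal images.
\<close>

lemma star_contraction_if_comparison_bounded:
  assumes "ordered_metric_space X d le" and "star \<in> binops n" and "subspace_of E X"
    and "F ` tuples n X \<subseteq> E" and "monotone_property n X le F" and "\<phi> \<in> Omega"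
    and metric: "Metric_space (tuples n X) D"
    and component_le: "\<And>i x y. i \<in> {1..n} \<Longrightarrow> d (x i) (y i) \<le> real n * D x y"
    and le_component_sum: "\<And>x y. D x y \<le> (\<Sum>i=1..n. d (x i) (y i))"
    and contr: "\<And>x y. x \<in> tuples n X \<Longrightarrow> y \<in> tuples n X \<Longrightarrow> comparable n le x y \<Longrightarrow>
      D (star_map n star F x) (star_map n star F y) \<le> \<phi> (D x y)"
  shows "star_contraction X d le n E star F D"
proof (intro star_contraction.intro star_contraction_axioms.intro)
  interpret D: Metric_space "tuples n X" D by (rule metric)
  let ?T = "star_map n star F"
  have F_X: "F ` tuples n X \<subseteq> X"
    using assms(3,4) by (auto simp: subspace_of_def)
  fix \<epsilon> :: real assume "0 < \<epsilon>"
  obtain \<delta> where \<delta>: "0 < \<delta>" "\<And>r. 0 < r \<Longrightarrow> r < \<epsilon> + \<delta> \<Longrightarrow> \<phi> r < \<epsilon>"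
    using Omega_Meir_Keeler[OF \<open>\<phi> \<in> Omega\<close> \<open>0 < \<epsilon>\<close>] by blast
  have "D (?T x) (?T y) < \<epsilon>"
    if xy: "x \<in> tuples n X" "y \<in> tuples n X" "comparable n le x y" "D x y < \<epsilon> + \<delta>" for x y
  proof (cases "x = y")
    case True
    then show ?thesis
      using star_map_closed[OF assms(2) F_X xy(1)] \<open>0 < \<epsilon>\<close> by simp
  next
    case False
    then have "0 < D x y" using xy by simp
    then show ?thesis using le_less_trans[OF contr[OF xy(1-3)] \<delta>(2)] xy(4) by blast
  qed
  then show "\<exists>\<delta>>0. \<forall>x\<in>tuples n X. \<forall>y\<in>tuples n X.
      comparable n le x y \<longrightarrow> D x y < \<epsilon> + \<delta> \<longrightarrow> D (?T x) (?T y) < \<epsilon>"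
    using \<delta>(1) by blast
qed (fact assms(1-5) metric component_le le_component_sum)+

lemma star_contraction_mean_or_max:
  assumes "0 < n" and "ordered_metric_space X d le" and "star \<in> binops n"
    and "subspace_of E X" and "F ` tuples n X \<subseteq> E" and "monotone_property n X le F"
    and "\<phi> \<in> Omega"
    and contr: "mean_contractive n X d le star F \<phi> \<or> max_contractive n X d le star F \<phi>"
  obtains D where "star_contraction X d le n E star F D"
proof -
  interpret ordered_metric_space X d le by fact
  let ?T = "star_map n star F"
  note from_bound = star_contraction_if_comparison_bounded[OF assms(2-7)]
  show thesis
    using contr
  proof
    assume contr: "mean_contractive n X d le star F \<phi>"
    have bound: "mean_dist n d (?T x) (?T y) \<le> \<phi> (mean_dist n d x y)"
      if "x \<in> tuples n X" "y \<in> tuples n X" "comparable n le x y" for x y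
      using contr that by (simp add: mean_contractive_def mean_dist_def star_map_def)
    show thesis
      by (rule that, rule from_bound[where D = "mean_dist n d"])
        (fact Metric_space_mean_dist[OF \<open>0 < n\<close>] mean_dist_bounds[OF \<open>0 < n\<close>] bound)+
  next
    assume contr: "max_contractive n X d le star F \<phi>"
    have bound: "max_dist n d (?T x) (?T y) \<le> \<phi> (max_dist n d x y)"
      if "x \<in> tuples n X" "y \<in> tuples n X" "comparable n le x y" for x y
    proof -
      have "max_dist n d (?T x) (?T y) =
          (MAX i\<in>{1..n}. d (F (star_tuple n star x i)) (F (star_tuple n star y i)))"
        unfolding max_dist_def by (intro arg_cong[where f = Max] image_cong) (auto simp: star_map_def)
      then show ?thesis using contr that by (simp add: max_contractive_def max_dist_def)
    qed
    show thesis
      by (rule that, rule from_bound[where D = "max_dist n d"])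
        (fact Metric_space_max_dist[OF \<open>0 < n\<close>] max_dist_bounds[OF \<open>0 < n\<close>] bound)+
  qed
qed

section \<open>Order reversal\<close>

lemma tuple_le_converse: "tuple_le n le\<inverse>\<inverse> x y \<longleftrightarrow> tuple_le n le y x"
  by (simp add: tuple_le_def)

lemma comparable_converse: "comparable n le\<inverse>\<inverse> = comparable n le"
  by (auto simp: comparable_def tuple_le_converse fun_eq_iff)

lemma increasing_seq_converse: "increasing_seq le\<inverse>\<inverse> s \<longleftrightarrow> decreasing_seq le s"
  by (simp add: increasing_seq_def decreasing_seq_def)

lemma ordered_metric_space_converse:
  assumes "ordered_metric_space X d le"
  shows "ordered_metric_space X d le\<inverse>\<inverse>"
proof -
  interpret ordered_metric_space X d le by fact
  show ?thesis
    by unfold_locales (use nonempty refl_le trans_le antisym_le in simp_all)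
qed

lemma monotone_property_converse:
  "monotone_property n X le F \<Longrightarrow> monotone_property n X le\<inverse>\<inverse> F"
  by (simp add: monotone_property_def monotone_on_def tuple_le_converse)

text \<open>
  Together with the other invariances under order reversal, these reduce the decreasing case to
  the increasing one.
\<close>

lemma upper_converse:
  "upper_O_complete E d le\<inverse>\<inverse> \<longleftrightarrow> lower_O_complete E d le"
  "upper_O_continuous n X d le\<inverse>\<inverse> F \<longleftrightarrow> lower_O_continuous n X d le F"
  "ICU E d le\<inverse>\<inverse> \<longleftrightarrow> DCL E d le"
  by (simp_all add: upper_O_complete_def lower_O_complete_def upper_O_continuous_def
      lower_O_continuous_def ICU_def DCL_def increasing_seq_converse)

lemma O_complete_upper_lower:
  "O_complete E d le \<Longrightarrow> upper_O_complete E d le \<and> lower_O_complete E d le"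
  by (simp add: O_complete_def upper_O_complete_def lower_O_complete_def monotone_seq_def)

lemma O_continuous_upper_lower:
  "O_continuous n X d le F \<Longrightarrow> upper_O_continuous n X d le F \<and> lower_O_continuous n X d le F"
  by (simp add: O_continuous_def upper_O_continuous_def lower_O_continuous_def monotone_seq_def)

section \<open>Existence and uniqueness\<close>

theorem theorem15:
  fixes n :: nat
    and X E :: "'a set"
    and d :: "'a \<Rightarrow> 'a \<Rightarrow> real"
    and le :: "'a \<Rightarrow> 'a \<Rightarrow> bool"
    and F :: "(nat \<Rightarrow> 'a) \<Rightarrow> 'a"
    and star :: "nat \<Rightarrow> nat \<Rightarrow> nat"
  assumes "n \<ge> 2"
    and "ordered_metric_space X d le"
    and "F \<in> tuples n X \<rightarrow> X"
    and "star \<in> binops n"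
    and "subspace_of E X"
    and "F ` tuples n X \<subseteq> E"
    and "monotone_property n X le F"
    and "\<exists>\<phi>\<in>Omega. mean_contractive n X d le star F \<phi> \<or> max_contractive n X d le star F \<phi>"
    and
     "(upper_O_complete E d le \<and>
       (upper_O_continuous n X d le F \<or> ICU E d le) \<and>
       (\<exists>x0\<in>tuples n X. \<forall>i\<in>{1..n}. le (x0 i) (F (star_tuple n star x0 i))))
      \<or>
      (lower_O_complete E d le \<and>
       (lower_O_continuous n X d le F \<or> DCL E d le) \<and>
       (\<exists>x0\<in>tuples n X. \<forall>i\<in>{1..n}. le (F (star_tuple n star x0 i)) (x0 i)))
      \<or>
      (O_complete E d le \<and>
       (O_continuous n X d le F \<or> MCB E d le) \<and>
       (\<exists>x0\<in>tuples n X.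
          (\<forall>i\<in>{1..n}. le (x0 i) (F (star_tuple n star x0 i))) \<or>
          (\<forall>i\<in>{1..n}. le (F (star_tuple n star x0 i)) (x0 i))))"
    and "\<forall>x\<in>tuples n X. \<forall>y\<in>tuples n X. \<exists>z\<in>tuples n X. comparable n le z x \<and> comparable n le z y"
  shows "\<exists>!x. star_fixed_point n X star F x"
proof -
  obtain \<phi> where phi: "\<phi> \<in> Omega"
    and contr: "mean_contractive n X d le star F \<phi> \<or> max_contractive n X d le star F \<phi>"
    using assms(8) by blast
  have "0 < n" using assms(1) by simp
  obtain D where up: "star_contraction X d le n E star F D"
    using star_contraction_mean_or_max[OF \<open>0 < n\<close> assms(2,4-7) phi contr] .
  have "mean_contractive n X d le\<inverse>\<inverse> star F \<phi> \<or> max_contractive n X d le\<inverse>\<inverse> star F \<phi>"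
    using contr by (simp add: mean_contractive_def max_contractive_def comparable_converse)
  from star_contraction_mean_or_max[OF \<open>0 < n\<close> ordered_metric_space_converse[OF assms(2)] assms(4-6)
      monotone_property_converse[OF assms(7)] phi this]
  obtain D' where down: "star_contraction X d le\<inverse>\<inverse> n E star F D'" .

  have increasing_case: ?thesis
    if "upper_O_complete E d le" "upper_O_continuous n X d le F \<or> ICU E d le"
      "\<exists>x0\<in>tuples n X. \<forall>i\<in>{1..n}. le (x0 i) (F (star_tuple n star x0 i))"
    using star_contraction.unique_star_fixed_point[OF up that assms(10)] .
  \<comment> \<open>The increasing case for the reversed order.\<close>
  have decreasing_case: ?thesis
    if "lower_O_complete E d le" "lower_O_continuous n X d le F \<or> DCL E d le"
      "\<exists>x0\<in>tuples n X. \<forall>i\<in>{1..n}. le (F (star_tuple n star x0 i)) (x0 i)"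
    using star_contraction.unique_star_fixed_point[OF down] that assms(10)
    by (simp add: upper_converse comparable_converse)
  from assms(9) show ?thesis
  proof (elim disjE)
    assume A: "O_complete E d le \<and> (O_continuous n X d le F \<or> MCB E d le) \<and>
       (\<exists>x0\<in>tuples n X.
          (\<forall>i\<in>{1..n}. le (x0 i) (F (star_tuple n star x0 i))) \<or>
          (\<forall>i\<in>{1..n}. le (F (star_tuple n star x0 i)) (x0 i)))"
    then have "upper_O_complete E d le" "lower_O_complete E d le"
      "upper_O_continuous n X d le F \<or> ICU E d le" "lower_O_continuous n X d le F \<or> DCL E d le"
      by (auto simp: MCB_def dest: O_complete_upper_lower O_continuous_upper_lower)
    then show ?thesis
      using A increasing_case decreasing_case by blast
  qed (use increasing_case decreasing_case in blast)+
qed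

end
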